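(* The triple $\mathbb M^\bullet_\cup=(M_\cup,\eta,\mu^\bullet)$ is a monad on the category of compacta and continuous maps. In particular, for every compactum $X$: (i) $\mu^\bullet X\circ\eta(M_\cup X)=\mu^\bullet X\circ M_\cup(\eta X)=\mathrm{id}_{M_\cup X}$; (ii) $\mu^\bullet X\circ\mu^\bullet(M_\cup X)=\mu^\bullet X\circ M_\cup(\mu^\bullet X)$ as maps $M_\cup(M_\cup(M_\cup X))\to M_\cup X$.
   Context: A compactum is a compact Hausdorff space; $I=[0,1]$; $\mathcal F(X)$ denotes the family of closed subsets of $X$. An (upper-semicontinuous) capacity on a compactum $X$ is a function $\nu:\mathcal F(X)\to I$ such that: (1) $\nu(X)=1$, $\nu(\emptyset)=0$; (2) if $F\subset G$ then $\nu(F)\le\nu(G)$; (3) if $\nu(F)<a$ then there is an open set $O\supset F$ with $\nu(B)<a$ for every closed $B\subset O$. $MX$ is the set of all capacities on $X$, topologized by the subbase consisting of the sets $\{c\in MX: c(F)<a\}$ ($F$ closed, $a\in I$) and $\{c\in MX: c(U)>a\}$ ($U$ open, $a\in I$), where $c(U)=\sup\{c(K):K\text{ closed},K\subset U\}$; it is a compactum. A capacity $\nu$ is a possibility capacity if $\nu(A\cup B)=\max\{\nu(A),\nu(B)\}$ for all closed $A,B$; $M_\cup X$ denotes the (closed) subspace of $MX$ of possibility capacities. For a continuous map $f:X\to Y$, $M_\cup f:M_\cup X\to M_\cup Y$ is $M_\cup f(c)(F)=c(f^{-1}(F))$; this makes $M_\cup$ an endofunctor of the category of compacta. $\eta X:X\to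 M_\cup X$ is $\eta X(x)(F)=1$ if $x\in F$ and $0$ otherwise. For a closed $F\subset X$ and $t\in I$ put $F_t=\{c\in M_\cup X: c(F)\ge t\}$, a closed subset of $M_\cup X$. The map $\mu^\bullet X: M_\cup(M_\cup X)\to M_\cup X$ is $\mu^\bullet X(\mathcal C)(F)=\max\{\mathcal C(F_t)\cdot t: t\in(0,1]\}$ (the maximum exists and the result is a possibility capacity). A monad $(T,\eta,\mu)$ on a category consists of an endofunctor $T$ and natural transformations $\eta:\mathrm{Id}\to T$, $\mu:T^2\to T$ with $\mu\circ T\eta=\mu\circ\eta T=1_T$ and $\mu\circ\mu T=\mu\circ T\mu$. *)

theory Defs
  imports "HOL-Analysis.Analysis"
begin

definition compactum :: "'a topology \<Rightarrow> bool" where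
  "compactum X \<longleftrightarrow> compact_space X \<and> Hausdorff_space X"

text \<open>Capacities are represented as functions on sets, taking the value 0 on
  sets that are not closed (so that they are uniquely determined by their
  values on the closed sets).\<close>
definition capacity :: "'a topology \<Rightarrow> ('a set \<Rightarrow> real) \<Rightarrow> bool" where
  "capacity X c \<longleftrightarrow>
     (\<forall>F. \<not> closedin X F \<longrightarrow> c F = 0) \<and>
     (\<forall>F. closedin X F \<longrightarrow> 0 \<le> c F \<and> c F \<le> 1) \<and>
     c (topspace X) = 1 \<and> c {} = 0 \<and>
     (\<forall>F G. closedin X F \<and> closedin X G \<and> F \<subseteq> G \<longrightarrow> c F \<le> c G) \<and>
     (\<forall>F a. closedin X F \<and> c F < a \<longrightarrow>
        (\<exists>V. openin X V \<and> F \<subseteq> V \<and> (\<forall>B. closedin X B \<and> B \<subseteq> V \<longrightarrow> c B < a)))"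

definition possibility_capacity :: "'a topology \<Rightarrow> ('a set \<Rightarrow> real) \<Rightarrow> bool" where
  "possibility_capacity X c \<longleftrightarrow> capacity X c \<and>
     (\<forall>A B. closedin X A \<and> closedin X B \<longrightarrow> c (A \<union> B) = max (c A) (c B))"

definition cap_open :: "'a topology \<Rightarrow> ('a set \<Rightarrow> real) \<Rightarrow> 'a set \<Rightarrow> real" where
  "cap_open X c U = Sup {c K | K. closedin X K \<and> K \<subseteq> U}"

definition MU :: "'a topology \<Rightarrow> ('a set \<Rightarrow> real) topology" where
  "MU X = topology_generated_by
     ({{c. possibility_capacity X c \<and> c F < a} | F a. closedin X F \<and> 0 \<le> a \<and> a \<le> 1} \<union>
      {{c. possibility_capacity X c \<and> cap_open X c U > a} | U a. openin X U \<and> 0 \<le> a \<and> a \<le> 1})"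

definition MU_map :: "'a topology \<Rightarrow> 'b topology \<Rightarrow> ('a \<Rightarrow> 'b)
    \<Rightarrow> ('a set \<Rightarrow> real) \<Rightarrow> ('b set \<Rightarrow> real)" where
  "MU_map X Y f c = (\<lambda>F. if closedin Y F then c (f -` F \<inter> topspace X) else 0)"

definition eta :: "'a topology \<Rightarrow> 'a \<Rightarrow> ('a set \<Rightarrow> real)" where
  "eta X x = (\<lambda>F. if closedin X F then (if x \<in> F then 1 else 0) else 0)"

definition level_set :: "'a topology \<Rightarrow> 'a set \<Rightarrow> real \<Rightarrow> ('a set \<Rightarrow> real) set" where
  "level_set X F t = {c \<in> topspace (MU X). c F \<ge> t}"

text \<open>The multiplication mu^bullet; the maximum over t in (0,1] is written as a
  supremum (it is attained, as stated in the paper).\<close>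
definition mu :: "'a topology \<Rightarrow> (('a set \<Rightarrow> real) set \<Rightarrow> real) \<Rightarrow> ('a set \<Rightarrow> real)" where
  "mu X C = (\<lambda>F. if closedin X F
                  then Sup ((\<lambda>t. C (level_set X F t) * t) ` {0<..1})
                  else 0)"

end

theory Submission
  imports Defs
begin

text \<open>On a compactum a possibility capacity \<open>c\<close> is determined by its density \<open>x \<mapsto> c {x}\<close>,
  because \<open>c F = max {c {x} | x. x \<in> F}\<close> for nonempty closed \<open>F\<close>, and the
  densities are exactly the upper semicontinuous
  functions into \<open>[0,1]\<close> attaining 1. In these terms \<open>mu X C F\<close> is the supremum of \<open>C {c} * c F\<close>
  over all \<open>c\<close>. Since evaluation \<open>(c, x) \<mapsto> c {x}\<close> is jointly upper semicontinuous and suprema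
  along a compact factor preserve upper semicontinuity, \<open>mu X C\<close> is a capacity and \<open>mu X\<close> is
  continuous. Associativity is the interchange of two suprema.\<close>

section \<open>Upper semicontinuous functions\<close>

text \<open>A value is handled through its nonnegative upper bounds (\<open>capacity_le_iff\<close>,
  \<open>mu_le_iff\<close>): suprema become universal quantifiers, and the empty set, where a real
  supremum has no meaning, costs only the condition \<open>0 \<le> b\<close>. The formula for
  \<open>mu\<close> holds because \<open>C\<close> of a level set is governed by the
  \<open>C {c}\<close> with \<open>c F \<ge> t\<close>, and for fixed \<open>c\<close> with
  \<open>c F > 0\<close> the best level is \<open>t = c F\<close>. The two kinds of subbasic sets of
  \<open>MU X\<close> give every continuity proof two halves: upper semicontinuity at each closed
  set, and a lower half in which \<open>cap_open\<close> is read as an existential statement about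
  densities, so that one witness suffices. All this is applied to capacities on \<open>MU X\<close>
  as well, hence \<open>MU X\<close> must be shown to be a compactum before the multiplication can
  be studied.\<close>

definition usc_map :: "'a topology \<Rightarrow> ('a \<Rightarrow> real) \<Rightarrow> bool" where
  "usc_map X u \<longleftrightarrow> (\<forall>a. openin X {x \<in> topspace X. u x < a})"

lemma usc_mapD: "usc_map X u \<Longrightarrow> openin X {x \<in> topspace X. u x < a}"
  by (simp add: usc_map_def)

lemma usc_map_compose:
  assumes "usc_map Y u" and f: "continuous_map X Y f"
  shows "usc_map X (\<lambda>x. u (f x))"
  unfolding usc_map_def
proof
  fix a
  have "openin X {x \<in> topspace X. f x \<in> {y \<in> topspace Y. u y < a}}"
    by (rule openin_continuous_map_preimage[OF f usc_mapD[OF assms(1)]])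
  moreover have "{x \<in> topspace X. f x \<in> {y \<in> topspace Y. u y < a}} = {x \<in> topspace X. u (f x) < a}"
    using continuous_map_funspace[OF f] by auto
  ultimately show "openin X {x \<in> topspace X. u (f x) < a}" by simp
qed

text \<open>For nonnegative factors, a product below \<open>a\<close> follows from the separate open
  conditions \<open>u < s\<close> and \<open>v < a / s\<close>.\<close>

lemma usc_map_mult:
  assumes u: "usc_map X u" and v: "usc_map X v"
    and u0: "\<And>x. x \<in> topspace X \<Longrightarrow> 0 \<le> u x" and v0: "\<And>x. x \<in> topspace X \<Longrightarrow> 0 \<le> v x"
  shows "usc_map X (\<lambda>x. u x * v x)"
  unfolding usc_map_def
proof
  fix a
  show "openin X {x \<in> topspace X. u x * v x < a}"
  proof (subst openin_subopen, safe)
    fix x assume x: "x \<in> topspace X" "u x * v x < a"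
    have a: "0 < a" using u0[OF x(1)] v0[OF x(1)] x(2)
      by (meson le_less_trans mult_nonneg_nonneg)
    \<comment> \<open>Any \<open>s\<close> between \<open>u x\<close> and \<open>a / v x\<close>
      will do. If \<open>v x = 0\<close> there is no upper constraint, and \<open>u x + 1\<close> is
      an arbitrary choice.\<close>
    obtain s where s: "u x < s" "s * v x < a"
    proof (cases "v x = 0")
      case True
      then show ?thesis using that[of "u x + 1"] a by simp
    next
      case False
      then have "0 < v x" using v0[OF x(1)] by simp
      then have "u x < a / v x" using x(2) by (simp add: pos_less_divide_eq)
      then obtain s where "u x < s" "s < a / v x" using dense by blast
      then show ?thesis using that \<open>0 < v x\<close> by (simp add: pos_less_divide_eq)
    qed
    have s0: "0 < s" using s(1) u0[OF x(1)] by simp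
    have vt: "v x < a / s" using s(2) s0 by (simp add: pos_less_divide_eq mult.commute)
    let ?T = "{x \<in> topspace X. u x < s} \<inter> {x \<in> topspace X. v x < a / s}"
    have "openin X ?T" using usc_mapD[OF u] usc_mapD[OF v] by blast
    moreover have "x \<in> ?T" using x s vt by simp
    moreover have "?T \<subseteq> {x \<in> topspace X. u x * v x < a}"
    proof safe
      fix y assume y: "y \<in> topspace X" "u y < s" "v y < a / s"
      have "u y * v y \<le> s * v y" using y v0[OF y(1)] by (simp add: mult_right_mono)
      also have "\<dots> < s * (a / s)" using y(3) s0 by (rule mult_strict_left_mono)
      also have "\<dots> = a" using s0 by simp
      finally show "u y * v y < a" .
    qed
    ultimately show "\<exists>T. openin X T \<and> x \<in> T \<and> T \<subseteq> {x \<in> topspace X. u x * v x < a}"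
      by blast
  qed
qed

text \<open>The supremum over a compact factor; stating it through upper bounds avoids a junk
  supremum when that factor is empty.\<close>
lemma usc_map_Sup_compact:
  assumes "compact_space Y" and w: "usc_map (prod_topology X Y) w"
    and v: "\<And>x b. x \<in> topspace X \<Longrightarrow> 0 \<le> b \<Longrightarrow> v x \<le> b \<longleftrightarrow> (\<forall>y\<in>topspace Y. w (x, y) \<le> b)"
    and v0: "\<And>x. x \<in> topspace X \<Longrightarrow> 0 \<le> v x"
  shows "usc_map X v"
  unfolding usc_map_def
proof
  fix a
  \<comment> \<open>\<open>G b\<close> consists of the points whose whole fibre stays strictly below
    \<open>b\<close>. It is open because projection along a compact factor is a closed map.\<close>
  define G where "G b = topspace X - fst ` {z \<in> topspace (prod_topology X Y). b \<le> w z}" for b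
  have G: "openin X (G b)" for b
  proof -
    have "closedin (prod_topology X Y) {z \<in> topspace (prod_topology X Y). b \<le> w z}"
    proof -
      have "{z \<in> topspace (prod_topology X Y). b \<le> w z} =
          topspace (prod_topology X Y) - {z \<in> topspace (prod_topology X Y). w z < b}"
        by (auto simp only: set_diff_eq mem_Collect_eq not_less)
      then show ?thesis using closedin_diff[OF closedin_topspace usc_mapD[OF w, of b]] by (simp only:)
    qed
    then have "closedin X (fst ` {z \<in> topspace (prod_topology X Y). b \<le> w z})"
      using closed_map_fst[OF assms(1), of X] unfolding closed_map_def by blast
    then show ?thesis unfolding G_def by blast
  qed
  have "{x \<in> topspace X. v x < a} = (\<Union>b\<in>{0<..<a}. G b)"
  proof safe
    fix x assume x: "x \<in> topspace X" "v x < a"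
    then obtain b where b: "v x < b" "b < a" using dense by blast
    \<comment> \<open>The hypothesis on \<open>v\<close> yields only weak bounds, while
      \<open>G b\<close> asks for strict ones; \<open>b'\<close> provides the gap.\<close>
    obtain b' where b': "v x < b'" "b' < b" using dense b by blast
    have "\<forall>y\<in>topspace Y. w (x, y) < b" using v[OF x(1), of "b'"] v0[OF x(1)] b' by fastforce
    then have "x \<in> G b" using x(1) unfolding G_def by force
    then show "x \<in> (\<Union>b\<in>{0<..<a}. G b)" using v0[OF x(1)] b by (intro UN_I[of b]) auto
  next
    fix x b assume "x \<in> G b" and b: "b \<in> {0<..<a}"
    have x: "x \<in> topspace X" using \<open>x \<in> G b\<close> unfolding G_def by blast
    have "w (x, y) \<le> b" if "y \<in> topspace Y" for y
    proof (rule ccontr)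
      assume "\<not> w (x, y) \<le> b"
      then have "(x, y) \<in> {z \<in> topspace (prod_topology X Y). b \<le> w z}" using x that by simp
      then have "x \<in> fst ` {z \<in> topspace (prod_topology X Y). b \<le> w z}" by (rule image_eqI[rotated]) simp
      then show False using \<open>x \<in> G b\<close> unfolding G_def by blast
    qed
    then have "v x \<le> b" using v[OF x, of b] b by simp
    then show "v x < a" using b by auto
    show "x \<in> topspace X" by fact
  qed
  then show "openin X {x \<in> topspace X. v x < a}" using G by auto
qed

section \<open>Possibility capacities and their densities\<close>

lemma compactum_closedin_sing: "compactum X \<Longrightarrow> x \<in> topspace X \<Longrightarrow> closedin X {x}"
  by (simp add: compactum_def closedin_Hausdorff_sing_eq)

lemma compactum_closedin_sing': "compactum X \<Longrightarrow> closedin X F \<Longrightarrow> x \<in> F \<Longrightarrow> closedin X {x}"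
  by (rule compactum_closedin_sing) (use closedin_subset in fast)+

text \<open>Capacities are controlled on closed sets only, so a neighbourhood comes as a pair:
  \<open>W\<close> for openness, \<open>K\<close> to carry the estimate.\<close>

lemma compactum_closed_nbhd:
  assumes "compactum X" "openin X V" "x \<in> V"
  obtains W K where "openin X W" "closedin X K" "x \<in> W" "W \<subseteq> K" "K \<subseteq> V"
proof -
  have "neighbourhood_base_of (closedin X) X"
    using assms(1) compact_Hausdorff_imp_regular_space neighbourhood_base_of_closedin
    unfolding compactum_def by blast
  then show ?thesis using that assms(2,3) unfolding neighbourhood_base_of by meson
qed

context
  fixes X :: "'a topology" and c
  assumes pc: "possibility_capacity X c"
begin

lemma capacity_nonclosed: "\<not> closedin X F \<Longrightarrow> c F = 0"
  and capacity_topspace: "c (topspace X) = 1"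
  and capacity_empty: "c {} = 0"
  and capacity_mono: "closedin X F \<Longrightarrow> closedin X G \<Longrightarrow> F \<subseteq> G \<Longrightarrow> c F \<le> c G"
  and capacity_usc: "closedin X F \<Longrightarrow> c F < a \<Longrightarrow>
    \<exists>V. openin X V \<and> F \<subseteq> V \<and> (\<forall>B. closedin X B \<and> B \<subseteq> V \<longrightarrow> c B < a)"
  and capacity_Un: "closedin X A \<Longrightarrow> closedin X B \<Longrightarrow> c (A \<union> B) = max (c A) (c B)"
  using pc by (simp_all add: possibility_capacity_def capacity_def)

lemma capacity_ge0: "0 \<le> c F" and capacity_le1: "c F \<le> 1"
  using pc by (cases "closedin X F"; simp add: possibility_capacity_def capacity_def)+

lemma capacity_Union_less:
  assumes "finite \<K>" "\<And>K. K \<in> \<K> \<Longrightarrow> closedin X K \<and> c K < a" "0 < a"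
  shows "c (\<Union>\<K>) < a"
  using assms
proof (induction \<K>)
  case empty
  then show ?case by (simp add: capacity_empty)
next
  case (insert K \<K>)
  have "closedin X (\<Union>\<K>)" using insert.hyps insert.prems by (intro closedin_Union) auto
  then have "c (K \<union> \<Union>\<K>) = max (c K) (c (\<Union>\<K>))" using insert.prems by (intro capacity_Un) auto
  moreover have "c K < a" "c (\<Union>\<K>) < a" using insert by auto
  ultimately show ?case by simp
qed

text \<open>Upper semicontinuity extends the bound from points to neighbourhoods; by compactness
  finitely many of them suffice, and maxitivity combines them.\<close>
lemma capacity_density_attained:
  assumes X: "compactum X" and F: "closedin X F" and a: "0 < a" "a \<le> c F"
  shows "\<exists>x\<in>F. a \<le> c {x}"
proof (rule ccontr)
  assume "\<not> ?thesis"
  then have less: "\<And>x. x \<in> F \<Longrightarrow> c {x} < a" by (simp add: not_le)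
  have "\<exists>W K. openin X W \<and> closedin X K \<and> x \<in> W \<and> W \<subseteq> K \<and> c K < a" if x: "x \<in> F" for x
  proof -
    have cl: "closedin X {x}" by (rule compactum_closedin_sing'[OF X F x])
    obtain V where V: "openin X V" "{x} \<subseteq> V" "\<forall>B. closedin X B \<and> B \<subseteq> V \<longrightarrow> c B < a"
      using capacity_usc[OF cl less[OF x]] by (elim exE conjE)
    have "x \<in> V" using V(2) by simp
    then obtain W K where "openin X W" "closedin X K" "x \<in> W" "W \<subseteq> K" "K \<subseteq> V"
      by (rule compactum_closed_nbhd[OF X V(1)])
    then show ?thesis using V(3) by blast
  qed
  then obtain W K where WK: "\<And>x. x \<in> F \<Longrightarrow> openin X (W x) \<and> closedin X (K x) \<and> x \<in> W x \<and> W x \<subseteq> K x \<and> c (K x) < a"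
    by metis
  have "compactin X F" using F X by (simp add: closedin_compact_space compactum_def)
  moreover have "F \<subseteq> \<Union>(W ` F)" using WK by blast
  moreover have "\<forall>U\<in>W ` F. openin X U" using WK by blast
  ultimately have "\<exists>\<F>. finite \<F> \<and> \<F> \<subseteq> W ` F \<and> F \<subseteq> \<Union>\<F>"
    unfolding compactin_def by blast
  then obtain T where T: "finite T" "T \<subseteq> F" "F \<subseteq> \<Union>(W ` T)"
    by (auto dest: finite_subset_image)
  have lt: "c (\<Union>(K ` T)) < a" using T WK by (intro capacity_Union_less) (use a in auto)
  have cl: "closedin X (\<Union>(K ` T))" using T WK by (intro closedin_Union) auto
  have sub: "F \<subseteq> \<Union>(K ` T)" using T WK by blast
  show False using capacity_mono[OF F cl sub] lt a by simp
qed

text \<open>If \<open>c F\<close> exceeded \<open>b\<close>, some point of \<open>F\<close> would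
  carry density at least \<open>c F\<close>. For empty \<open>F\<close> the right side is vacuous
  and the left side reads \<open>0 \<le> b\<close>, whence the assumption on
  \<open>b\<close>.\<close>

lemma capacity_le_iff:
  assumes X: "compactum X" and F: "closedin X F" and b: "0 \<le> b"
  shows "c F \<le> b \<longleftrightarrow> (\<forall>x\<in>F. c {x} \<le> b)"
proof
  assume L: "c F \<le> b"
  show "\<forall>x\<in>F. c {x} \<le> b"
  proof
    fix x assume "x \<in> F"
    then have "c {x} \<le> c F" using F compactum_closedin_sing'[OF X F]
      by (intro capacity_mono) auto
    with L show "c {x} \<le> b" by simp
  qed
next
  assume R: "\<forall>x\<in>F. c {x} \<le> b"
  show "c F \<le> b"
  proof (rule ccontr)
    assume "\<not> c F \<le> b"
    then have "0 < c F" using b by simp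
    then obtain x where "x \<in> F" "c F \<le> c {x}"
      using capacity_density_attained[OF X F] by blast
    with R \<open>\<not> c F \<le> b\<close> show False by force
  qed
qed

lemma usc_map_density:
  assumes X: "compactum X"
  shows "usc_map X (\<lambda>x. c {x})"
  unfolding usc_map_def
proof
  fix a
  show "openin X {x \<in> topspace X. c {x} < a}"
  proof (subst openin_subopen, safe)
    fix x assume x: "x \<in> topspace X" "c {x} < a"
    obtain V where V: "openin X V" "{x} \<subseteq> V" "\<forall>B. closedin X B \<and> B \<subseteq> V \<longrightarrow> c B < a"
      using capacity_usc[OF compactum_closedin_sing[OF X x(1)] x(2)] by (elim exE conjE)
    then have "V \<subseteq> {x \<in> topspace X. c {x} < a}"
      using compactum_closedin_sing[OF X] openin_subset by blast
    with V show "\<exists>T. openin X T \<and> x \<in> T \<and> T \<subseteq> {x \<in> topspace X. c {x} < a}" by auto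
  qed
qed

text \<open>Being strict, the inequality is witnessed by a single closed set inside
  \<open>U\<close>, and then by a single point of it. This removes \<open>cap_open\<close> from all
  later arguments about the topology.\<close>

lemma cap_open_gt_iff:
  assumes X: "compactum X" and U: "openin X U" and a: "0 \<le> a"
  shows "a < cap_open X c U \<longleftrightarrow> (\<exists>x\<in>U. a < c {x})"
proof -
  have bdd: "bdd_above {c K | K. closedin X K \<and> K \<subseteq> U}"
    using capacity_le1 by (auto intro!: bdd_aboveI[of _ 1])
  have ne: "{c K | K. closedin X K \<and> K \<subseteq> U} \<noteq> {}" by blast
  have "a < cap_open X c U \<longleftrightarrow> (\<exists>K. closedin X K \<and> K \<subseteq> U \<and> a < c K)"
    unfolding cap_open_def less_cSup_iff[OF ne bdd] by blast
  also have "\<dots> \<longleftrightarrow> (\<exists>x\<in>U. a < c {x})"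
  proof
    assume "\<exists>K. closedin X K \<and> K \<subseteq> U \<and> a < c K"
    then show "\<exists>x\<in>U. a < c {x}" using capacity_le_iff[OF X _ a] by (meson not_le subsetD)
  next
    assume "\<exists>x\<in>U. a < c {x}"
    then show "\<exists>K. closedin X K \<and> K \<subseteq> U \<and> a < c K"
      using compactum_closedin_sing[OF X] openin_subset[OF U] by blast
  qed
  finally show ?thesis .
qed

end

lemma possibility_capacity_eqI:
  assumes X: "compactum X" and c: "possibility_capacity X c" and d: "possibility_capacity X d"
    and eq: "\<And>x. x \<in> topspace X \<Longrightarrow> c {x} = d {x}"
  shows "c = d"
proof
  fix F
  show "c F = d F"
  proof (cases "closedin X F")
    case True
    have sub: "F \<subseteq> topspace X" using True by (rule closedin_subset)
    have "c F \<le> d F"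
      using capacity_le_iff[OF d X True capacity_ge0[OF d], of F] eq sub
      unfolding capacity_le_iff[OF c X True capacity_ge0[OF d]] by (auto simp: subset_iff)
    moreover have "d F \<le> c F"
      using capacity_le_iff[OF c X True capacity_ge0[OF c], of F] eq sub
      unfolding capacity_le_iff[OF d X True capacity_ge0[OF c]] by (auto simp: subset_iff)
    ultimately show ?thesis by simp
  qed (simp add: capacity_nonclosed[OF c] capacity_nonclosed[OF d])
qed

text \<open>The upper-bound description in the last premise already forces monotonicity, maxitivity
  and condition (3), whatever formula defines \<open>c\<close>. It thus applies to suprema of
  densities, to \<open>eta\<close> and to \<open>mu\<close> alike.\<close>

lemma possibility_capacityI:
  assumes nc: "\<And>F. \<not> closedin X F \<Longrightarrow> c F = 0"
    and u: "usc_map X u" and u1: "\<And>x. x \<in> topspace X \<Longrightarrow> u x \<le> 1"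
    and ex: "\<exists>x\<in>topspace X. u x = 1"
    and c0: "\<And>F. 0 \<le> c F"
    and le: "\<And>F b. closedin X F \<Longrightarrow> 0 \<le> b \<Longrightarrow> c F \<le> b \<longleftrightarrow> (\<forall>x\<in>F. u x \<le> b)"
  shows "possibility_capacity X c"
proof -
  have le1: "c F \<le> 1" if "closedin X F" for F
    using le[OF that, of 1] u1 closedin_subset[OF that] by auto
  have ule: "u x \<le> c F" if "closedin X F" "x \<in> F" for x F
    using le[OF that(1) c0, of F] that(2) by auto
  have top: "c (topspace X) = 1"
    using le1[of "topspace X"] ex ule[of "topspace X"] by fastforce
  have empty: "c {} = 0" using le[of "{}" 0] c0[of "{}"] by auto
  have mono: "c F \<le> c G" if "closedin X F" "closedin X G" "F \<subseteq> G" for F G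
    using le[OF that(1) c0, of G] ule[OF that(2)] that(3) by blast
  have usc: "\<exists>V. openin X V \<and> F \<subseteq> V \<and> (\<forall>B. closedin X B \<and> B \<subseteq> V \<longrightarrow> c B < a)"
    if F: "closedin X F" "c F < a" for F a
  proof -
    \<comment> \<open>A pointwise strict bound on \<open>B\<close> gives only a weak bound on
      \<open>c B\<close>, so a value strictly below \<open>a\<close> is interposed.\<close>
    obtain b where b: "c F < b" "b < a" using dense F(2) by blast
    let ?V = "{x \<in> topspace X. u x < b}"
    have "F \<subseteq> ?V" using ule[OF F(1)] b closedin_subset[OF F(1)] by force
    moreover have "c B < a" if "closedin X B" "B \<subseteq> ?V" for B
    proof -
      have "\<forall>x\<in>B. u x \<le> b" using that(2) by auto
      then have "c B \<le> b" using le[OF that(1), of b] b(1) c0[of F] by auto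
      with b show ?thesis by simp
    qed
    ultimately show ?thesis using usc_mapD[OF u, of b] by blast
  qed
  have un: "c (A \<union> B) = max (c A) (c B)" if AB: "closedin X A" "closedin X B" for A B
  proof (rule antisym)
    have cl: "closedin X (A \<union> B)" using AB by blast
    show "c (A \<union> B) \<le> max (c A) (c B)"
      using le[OF cl, of "max (c A) (c B)"] c0[of A] ule[OF AB(1)] ule[OF AB(2)]
      by (auto simp: le_max_iff_disj)
    show "max (c A) (c B) \<le> c (A \<union> B)" using mono[OF _ cl] AB by auto
  qed
  show ?thesis
    unfolding possibility_capacity_def capacity_def
    using nc c0 le1 top empty mono usc un by (intro conjI allI impI; (elim conjE)?) auto
qed

lemma possibility_capacity_of_density:
  assumes X: "compactum X" and u: "usc_map X u"
    and u01: "\<And>x. x \<in> topspace X \<Longrightarrow> 0 \<le> u x \<and> u x \<le> 1"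
    and ex: "\<exists>x\<in>topspace X. u x = 1"
  obtains c where "possibility_capacity X c" "\<And>x. x \<in> topspace X \<Longrightarrow> c {x} = u x"
proof
  \<comment> \<open>The empty set is treated separately because its real supremum is
    unspecified.\<close>
  define c where "c F = (if closedin X F \<and> F \<noteq> {} then Sup (u ` F) else 0)" for F
  have bdd: "bdd_above (u ` F)" if "closedin X F" for F
    using u01 closedin_subset[OF that] by (intro bdd_aboveI[of _ 1]) auto
  have c0: "0 \<le> c F" for F
  proof (cases "closedin X F \<and> F \<noteq> {}")
    case True
    then obtain x where "x \<in> F" by blast
    then have "u x \<le> Sup (u ` F)" using bdd True by (intro cSup_upper) auto
    moreover have "0 \<le> u x" using u01 \<open>x \<in> F\<close> True closedin_subset by blast
    ultimately show ?thesis using True by (simp add: c_def)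
  qed (auto simp: c_def)
  have le: "c F \<le> b \<longleftrightarrow> (\<forall>x\<in>F. u x \<le> b)" if "closedin X F" "0 \<le> b" for F b
    using that bdd[OF that(1)] by (cases "F = {}") (auto simp: c_def cSup_le_iff)
  show "possibility_capacity X c"
    by (rule possibility_capacityI[OF _ u _ ex c0 le]) (use u01 in \<open>auto simp: c_def\<close>)
  show "c {x} = u x" if "x \<in> topspace X" for x
    using compactum_closedin_sing[OF X that] by (simp add: c_def)
qed

section \<open>The space of possibility capacities\<close>

abbreviation MU_less :: "'a topology \<Rightarrow> 'a set \<Rightarrow> real \<Rightarrow> ('a set \<Rightarrow> real) set" where
  "MU_less X F a \<equiv> {c. possibility_capacity X c \<and> c F < a}"

abbreviation MU_greater :: "'a topology \<Rightarrow> 'a set \<Rightarrow> real \<Rightarrow> ('a set \<Rightarrow> real) set" where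
  "MU_greater X U a \<equiv> {c. possibility_capacity X c \<and> cap_open X c U > a}"

definition MU_subbase :: "'a topology \<Rightarrow> ('a set \<Rightarrow> real) set set" where
  "MU_subbase X =
    {MU_less X F a | F a. closedin X F \<and> 0 \<le> a \<and> a \<le> 1} \<union>
    {MU_greater X U a | U a. openin X U \<and> 0 \<le> a \<and> a \<le> 1}"

lemma MU_eq_generated: "MU X = topology_generated_by (MU_subbase X)"
  by (simp only: MU_def MU_subbase_def)

lemma MU_less_in_subbase: "closedin X F \<Longrightarrow> 0 \<le> a \<Longrightarrow> a \<le> 1 \<Longrightarrow> MU_less X F a \<in> MU_subbase X"
  and MU_greater_in_subbase: "openin X U \<Longrightarrow> 0 \<le> a \<Longrightarrow> a \<le> 1 \<Longrightarrow> MU_greater X U a \<in> MU_subbase X"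
  unfolding MU_subbase_def by blast+

lemma MU_subbaseE:
  assumes "W \<in> MU_subbase X"
  obtains F a where "W = MU_less X F a" "closedin X F" "0 \<le> a" "a \<le> 1"
  | U a where "W = MU_greater X U a" "openin X U" "0 \<le> a" "a \<le> 1"
  using assms unfolding MU_subbase_def by blast

text \<open>Since every capacity vanishes at the empty set, the subbasic set
  \<open>MU_less X {} 1\<close> is already the whole space.\<close>

lemma Union_MU_subbase: "\<Union> (MU_subbase X) = {c. possibility_capacity X c}"
proof
  show "\<Union> (MU_subbase X) \<subseteq> {c. possibility_capacity X c}"
    by (auto elim!: MU_subbaseE)
  have "c \<in> MU_less X {} 1" if "possibility_capacity X c" for c
    using that capacity_empty[OF that] by simp
  then show "{c. possibility_capacity X c} \<subseteq> \<Union> (MU_subbase X)"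
    using MU_less_in_subbase[of X "{}" 1] by auto
qed

lemma topspace_MU: "topspace (MU X) = {c. possibility_capacity X c}"
  by (simp only: MU_eq_generated topology_generated_by_topspace Union_MU_subbase)

text \<open>The subbase provides thresholds in \<open>[0,1]\<close> only; for other thresholds the
  set is empty or the whole space.\<close>

lemma usc_map_MU_eval:
  assumes "closedin X F"
  shows "usc_map (MU X) (\<lambda>c. c F)"
  unfolding usc_map_def
proof
  fix a :: real
  consider "a < 0" | "0 \<le> a" "a \<le> 1" | "1 < a" by linarith
  then show "openin (MU X) {c \<in> topspace (MU X). c F < a}"
  proof cases
    case 1
    then have "c F < a \<longleftrightarrow> False" if "c \<in> topspace (MU X)" for c
      using capacity_ge0[of X c F] that by (auto simp: topspace_MU)
    then show ?thesis by (simp cong: conj_cong)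
  next
    case 2
    then have "openin (MU X) {c. possibility_capacity X c \<and> c F < a}"
      unfolding MU_eq_generated using assms by (intro topology_generated_by_Basis MU_less_in_subbase)
    then show ?thesis by (simp add: topspace_MU)
  next
    case 3
    then have "c F < a \<longleftrightarrow> True" if "c \<in> topspace (MU X)" for c
      using capacity_le1[of X c F] that by (auto simp: topspace_MU)
    then have "{c \<in> topspace (MU X). c F < a} = topspace (MU X)" by blast
    then show ?thesis by simp
  qed
qed

lemma openin_MU_gt:
  assumes X: "compactum X" and U: "openin X U" and a: "0 \<le> a"
  shows "openin (MU X) {c \<in> topspace (MU X). \<exists>x\<in>U. a < c {x}}"
proof (cases "a \<le> 1")
  case True
  have "{c \<in> topspace (MU X). \<exists>x\<in>U. a < c {x}} = {c. possibility_capacity X c \<and> a < cap_open X c U}"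
    using cap_open_gt_iff[OF _ X U a] by (auto simp: topspace_MU)
  moreover have "openin (MU X) {c. possibility_capacity X c \<and> cap_open X c U > a}"
    unfolding MU_eq_generated using U a True by (intro topology_generated_by_Basis MU_greater_in_subbase)
  ultimately show ?thesis by simp
next
  case False
  have "\<not> a < c {x}" if "c \<in> topspace (MU X)" for c x
    using capacity_le1[of X c "{x}"] that False by (auto simp: topspace_MU)
  then have "{c \<in> topspace (MU X). \<exists>x\<in>U. a < c {x}} = {}" by blast
  then show ?thesis by (simp only: openin_empty)
qed

text \<open>The two nontrivial premises are the preimages of the two kinds of subbasic sets, the
  second one rewritten by \<open>cap_open_gt_iff\<close>.\<close>

lemma continuous_map_into_MU:
  assumes Y: "compactum Y"
    and g: "\<And>t. t \<in> topspace T \<Longrightarrow> possibility_capacity Y (g t)"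
    and lt: "\<And>F. closedin Y F \<Longrightarrow> usc_map T (\<lambda>t. g t F)"
    and gt: "\<And>U a. openin Y U \<Longrightarrow> 0 \<le> a \<Longrightarrow> openin T {t \<in> topspace T. \<exists>y\<in>U. a < g t {y}}"
  shows "continuous_map T (MU Y) g"
  unfolding MU_eq_generated
proof (rule continuous_on_generated_topo)
  show "g ` topspace T \<subseteq> \<Union> (MU_subbase Y)"
    using g by (auto simp: Union_MU_subbase)
next
  fix W assume "W \<in> MU_subbase Y"
  then show "openin T (g -` W \<inter> topspace T)"
  proof (cases rule: MU_subbaseE)
    case (1 F a)
    then have "g -` W \<inter> topspace T = {t \<in> topspace T. g t F < a}" using g by auto
    then show ?thesis using usc_mapD[OF lt[OF 1(2)]] by simp
  next
    case (2 U a)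
    then have "g -` W \<inter> topspace T = {t \<in> topspace T. \<exists>y\<in>U. a < g t {y}}"
      using g cap_open_gt_iff[OF g Y 2(2,3)] by auto
    then show ?thesis using gt[OF 2(2,3)] by simp
  qed
qed

section \<open>Compactness of the space of capacities\<close>

text \<open>Links the inductively generated topology to the description by unions of finite
  intersections in which Alexander's lemma is phrased.\<close>

lemma topology_generated_by_subbase:
  "topology_generated_by \<S> =
    topology (arbitrary union_of (finite intersection_of (\<lambda>x. x \<in> \<S>) relative_to \<Union>\<S>))"
    (is "_ = topology ?P")
proof -
  have P: "openin (topology ?P) = ?P"
    by (rule topology_inverse') (rule istopology_subbase)
  have "openin (topology_generated_by \<S>) s \<longleftrightarrow> ?P s" for s
  proof
    assume "openin (topology_generated_by \<S>) s"
    then have "generate_topology_on \<S> s" by (rule openin_topology_generated_by)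
    then have "openin (topology ?P) s"
    proof induction
      case (Basis s)
      have "(finite intersection_of (\<lambda>x. x \<in> \<S>)) s"
        by (rule finite_intersection_of_inc) (rule Basis)
      then have "(finite intersection_of (\<lambda>x. x \<in> \<S>) relative_to \<Union>\<S>) (\<Union>\<S> \<inter> s)"
        by (rule relative_to_inc)
      moreover have "\<Union>\<S> \<inter> s = s" using Basis by blast
      ultimately have "(finite intersection_of (\<lambda>x. x \<in> \<S>) relative_to \<Union>\<S>) s" by (simp only:)
      then show ?case unfolding P by (rule arbitrary_union_of_inc)
    qed auto
    then show "?P s" by (simp only: P)
  next
    assume "?P s"
    then obtain \<U> where \<U>: "\<Union>\<U> = s"
      "\<And>T. T \<in> \<U> \<Longrightarrow> (finite intersection_of (\<lambda>x. x \<in> \<S>) relative_to \<Union>\<S>) T"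
      unfolding union_of_def arbitrary_def by blast
    have "openin (topology_generated_by \<S>) T" if T: "T \<in> \<U>" for T
    proof -
      obtain V where V: "(finite intersection_of (\<lambda>x. x \<in> \<S>)) V" "T = \<Union>\<S> \<inter> V"
        using \<U>(2)[OF T] unfolding relative_to_def by blast
      obtain \<V> where "finite \<V>" "\<V> \<subseteq> \<S>" "V = \<Inter>\<V>"
        using V(1) unfolding intersection_of_def by blast
      then have T: "T = topspace (topology_generated_by \<S>) \<inter> \<Inter>\<V>" using V(2) by simp
      have "openin (topology_generated_by \<S>) W" if "W \<in> \<V>" for W
        using that \<open>\<V> \<subseteq> \<S>\<close> by (intro topology_generated_by_Basis) blast
      \<comment> \<open>The empty intersection is the whole type, and intersecting it with the space
        leaves the space itself.\<close>
      then show ?thesis unfolding T using \<open>finite \<V>\<close>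
        by (cases "\<V> = {}") (simp_all only: Inter_empty Int_UNIV_right openin_topspace,
            intro openin_Int openin_topspace openin_Inter)
    qed
    then show "openin (topology_generated_by \<S>) s" using \<U>(1) by blast
  qed
  then show ?thesis by (simp add: topology_eq P)
qed

text \<open>By Alexander's subbase lemma it suffices to treat covers by subbasic sets. The largest
  capacity avoiding all the sets \<open>{c. c(U) > b}\<close> of the cover has density
  \<open>u x = inf {b. x \<in> U}\<close>. If \<open>u\<close> does not attain 1, or if this capacity lies in a set
  \<open>{c. c F < a}\<close> of the cover, then the sets \<open>U\<close> with \<open>b < a\<close> cover \<open>F\<close> (respectively, those with
  \<open>b < 1\<close> cover the space), and compactness yields a finite subcover.\<close>
lemma compact_space_MU:
  assumes X: "compactum X"
  shows "compact_space (MU X)"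
proof -
  show ?thesis
  proof (rule Alexander_subbase)
    show "topology (arbitrary union_of (finite intersection_of (\<lambda>x. x \<in> MU_subbase X)
        relative_to \<Union>(MU_subbase X))) = MU X"
      unfolding MU_eq_generated by (rule topology_generated_by_subbase[symmetric])
  next
    fix \<C> assume \<C>: "\<C> \<subseteq> MU_subbase X" "\<Union>\<C> = topspace (MU X)"
    define J where "J = {(U, b). openin X U \<and> 0 \<le> b \<and> b \<le> 1 \<and> MU_greater X U b \<in> \<C>}"
    have J: "openin X U" "0 \<le> b" "MU_greater X U b \<in> \<C>" if "(U, b) \<in> J" for U b
      using that by (auto simp: J_def)
    \<comment> \<open>If \<open>c F \<ge> a\<close>, some point of \<open>F\<close> has density at
      least \<open>a\<close> and lies in a selected \<open>U\<close> with
      \<open>\<beta> U < a\<close>, so \<open>c\<close> is covered by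
      \<open>MU_greater X U (\<beta> U)\<close>. The family \<open>\<D>\<close> takes care of the
      capacities with \<open>c F < a\<close>.\<close>
    have finite_subcover: "\<exists>\<C>'. finite \<C>' \<and> \<C>' \<subseteq> \<C> \<and> \<Union>\<C>' = topspace (MU X)"
      if F: "closedin X F" "F \<subseteq> \<Union>{U. \<exists>b. (U, b) \<in> J \<and> b < a}" "0 < a"
        and \<D>: "finite \<D>" "\<D> \<subseteq> \<C>" "\<And>c. possibility_capacity X c \<Longrightarrow> c F < a \<Longrightarrow> c \<in> \<Union>\<D>" for F a \<D>
    proof -
      have "compactin X F" using F(1) X by (simp add: closedin_compact_space compactum_def)
      then have "\<exists>\<U>. finite \<U> \<and> \<U> \<subseteq> {U. \<exists>b. (U, b) \<in> J \<and> b < a} \<and> F \<subseteq> \<Union>\<U>"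
        by (rule compactinD) (use J(1) F(2) in auto)
      then obtain \<U> where \<U>: "finite \<U>" "\<U> \<subseteq> {U. \<exists>b. (U, b) \<in> J \<and> b < a}" "F \<subseteq> \<Union>\<U>"
        by (elim exE conjE)
      then have "\<forall>U\<in>\<U>. \<exists>b. (U, b) \<in> J \<and> b < a" by blast
      then obtain \<beta> where \<beta>: "\<And>U. U \<in> \<U> \<Longrightarrow> (U, \<beta> U) \<in> J \<and> \<beta> U < a" by metis
      let ?C = "\<D> \<union> (\<lambda>U. MU_greater X U (\<beta> U)) ` \<U>"
      have "c \<in> \<Union>?C" if c: "possibility_capacity X c" for c
      proof (cases "c F < a")
        case False
        then obtain x where x: "x \<in> F" "a \<le> c {x}"
          using capacity_density_attained[OF c X F(1,3)] by (auto simp: not_less)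
        then obtain U where U: "U \<in> \<U>" "x \<in> U" using \<U>(3) by blast
        then have "\<beta> U < c {x}" using \<beta> x by force
        then have "\<beta> U < cap_open X c U"
          using cap_open_gt_iff[OF c X J(1,2)] \<beta>[OF U(1)] U(2) by blast
        then show ?thesis using U(1) c by blast
      qed (use \<D>(3)[OF c] in blast)
      then have "topspace (MU X) \<subseteq> \<Union>?C" by (auto simp: topspace_MU)
      moreover have sub: "?C \<subseteq> \<C>" using \<D>(2) \<beta> J(3) by blast
      moreover have "\<Union>?C \<subseteq> topspace (MU X)" using sub \<C>(2) by blast
      ultimately show ?thesis using \<U>(1) \<D>(1) by (intro exI[of _ ?C]) auto
    qed
    show "\<exists>\<C>'. finite \<C>' \<and> \<C>' \<subseteq> \<C> \<and> \<Union>\<C>' = topspace (MU X)"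
    proof (rule ccontr)
      assume no: "\<not> ?thesis"
      \<comment> \<open>The inserted 1 is the value at points lying in no \<open>U\<close>; it also
        keeps the infimum meaningful and at most 1.\<close>
      define u where "u x = Inf (insert 1 {b. \<exists>U. (U, b) \<in> J \<and> x \<in> U})" for x
      have bdd: "bdd_below (insert 1 {b. \<exists>U. (U, b) \<in> J \<and> x \<in> U})" for x
        using J(2) by (intro bdd_belowI[of _ 0]) auto
      have u_less: "u x < a \<longleftrightarrow> 1 < a \<or> (\<exists>U b. (U, b) \<in> J \<and> x \<in> U \<and> b < a)" for x a
        unfolding u_def using cInf_less_iff[OF _ bdd, of x a] by auto
      have u01: "0 \<le> u x \<and> u x \<le> 1" for x
        using u_less[of x 0] J(2) cInf_lower[OF _ bdd, of 1 x] unfolding u_def by force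
      have u_cover: "x \<in> \<Union>{U. \<exists>b. (U, b) \<in> J \<and> b < a}" if "u x < a" "a \<le> 1" for x a
        using that by (simp add: u_less) blast
      have "usc_map X u"
        unfolding usc_map_def
      proof
        fix a
        show "openin X {x \<in> topspace X. u x < a}"
        proof (cases "1 < a")
          case True
          then show ?thesis by (simp add: u_less)
        next
          case False
          then have "{x \<in> topspace X. u x < a} = \<Union>{U. \<exists>b. (U, b) \<in> J \<and> b < a}"
            using openin_subset[OF J(1)] by (auto simp: u_less)
          then show ?thesis using J(1) by auto
        qed
      qed
      moreover have "\<exists>x\<in>topspace X. u x = 1"
      proof (rule ccontr)
        assume "\<not> ?thesis"
        then have "u x < 1" if "x \<in> topspace X" for x using that u01[of x] by force
        then have "topspace X \<subseteq> \<Union>{U. \<exists>b. (U, b) \<in> J \<and> b < 1}"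
          using u_cover[OF _ order_refl] by (intro subsetI) simp
        \<comment> \<open>With \<open>F = topspace X\<close> and \<open>a = 1\<close> no capacity
          satisfies \<open>c F < a\<close>, so \<open>\<D>\<close> may be empty.\<close>
        from finite_subcover[OF closedin_topspace this, of "{}"] no show False
          by (auto simp: capacity_topspace)
      qed
      ultimately obtain c where c: "possibility_capacity X c" "\<And>x. x \<in> topspace X \<Longrightarrow> c {x} = u x"
        using possibility_capacity_of_density[OF X, of u] u01 by blast
      then obtain B where B: "B \<in> \<C>" "c \<in> B" using \<C>(2) by (auto simp: topspace_MU)
      from B(1) \<C>(1) have "B \<in> MU_subbase X" by blast
      then show False
      proof (cases rule: MU_subbaseE)
        case (1 F a)
        then have "c F < a" using B(2) by simp
        then have "0 < a" using capacity_ge0[OF c(1), of F] by simp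
        have "c {x} \<le> c F" if "x \<in> F" for x
          using capacity_le_iff[OF c(1) X 1(2) capacity_ge0[OF c(1)], of F] that by simp
        then have "u x < a" if "x \<in> F" for x
          using that \<open>c F < a\<close> c(2)[of x] closedin_subset[OF 1(2)] by fastforce
        then have "F \<subseteq> \<Union>{U. \<exists>b. (U, b) \<in> J \<and> b < a}" 
          using u_cover[OF _ 1(4)] by (intro subsetI) simp
        from finite_subcover[OF 1(2) this \<open>0 < a\<close>, of "{B}"] no B(1) show False
          by (auto simp: 1(1))
      next
        case (2 U b)
        then have "(U, b) \<in> J" using B(1) by (simp add: J_def)
        have "b < cap_open X c U" using B(2) 2(1) by simp
        then obtain x where "x \<in> U" "b < c {x}" using cap_open_gt_iff[OF c(1) X 2(2,3)] by blast
        then have "b < u x" using c(2) openin_subset[OF 2(2)] by auto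
        moreover have "u x \<le> b" unfolding u_def
          using \<open>(U, b) \<in> J\<close> \<open>x \<in> U\<close> by (intro cInf_lower[OF _ bdd]) blast
        ultimately show False by simp
      qed
    qed
  qed
qed

section \<open>The Hausdorff property\<close>

text \<open>Distinct capacities have distinct densities at some \<open>x\<close>. For
  \<open>a\<close> strictly between the two values and \<open>x \<in> W \<subseteq> K\<close>, the
  conditions \<open>e K < a\<close> and "density above \<open>a\<close> somewhere on
  \<open>W\<close>" exclude each other by monotonicity.\<close>

lemma Hausdorff_space_MU:
  assumes X: "compactum X"
  shows "Hausdorff_space (MU X)"
proof -
  have sep: "\<exists>U V. openin (MU X) U \<and> openin (MU X) V \<and> c \<in> U \<and> d \<in> V \<and> disjnt U V"
    if c: "c \<in> topspace (MU X)" and d: "d \<in> topspace (MU X)"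
      and x: "x \<in> topspace X" and less: "c {x} < d {x}" for c d x
  proof -
    have pc: "possibility_capacity X c" "possibility_capacity X d" using c d by (auto simp: topspace_MU)
    obtain a where a: "c {x} < a" "a < d {x}" using dense less by blast
    have a0: "0 \<le> a" using a(1) capacity_ge0[OF pc(1), of "{x}"] by simp
    obtain V where V: "openin X V" "{x} \<subseteq> V" "\<forall>B. closedin X B \<and> B \<subseteq> V \<longrightarrow> c B < a"
      using capacity_usc[OF pc(1) compactum_closedin_sing[OF X x] a(1)] by (elim exE conjE)
    have "x \<in> V" using V(2) by simp
    then obtain W K where K: "openin X W" "closedin X K" "x \<in> W" "W \<subseteq> K" "K \<subseteq> V"
      by (rule compactum_closed_nbhd[OF X V(1)])
    let ?A = "{e \<in> topspace (MU X). e K < a}" and ?B = "{e \<in> topspace (MU X). \<exists>x\<in>W. a < e {x}}"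
    have "openin (MU X) ?A" "openin (MU X) ?B"
      using usc_mapD[OF usc_map_MU_eval[OF K(2)]] openin_MU_gt[OF X K(1) a0] by auto
    moreover have "c \<in> ?A" "d \<in> ?B" using c d V(3) K a by auto
    moreover have "disjnt ?A ?B"
    proof -
      have "\<not> (\<exists>x\<in>W. a < e {x})" if "possibility_capacity X e" "e K < a" for e
        using capacity_le_iff[OF that(1) X K(2) a0] that(2) K(4) by (auto simp: not_less)
      then show ?thesis by (auto simp: disjnt_iff topspace_MU)
    qed
    ultimately show ?thesis by blast
  qed
  show ?thesis
    unfolding Hausdorff_space_def
  proof clarify
    fix c d assume cd: "c \<in> topspace (MU X)" "d \<in> topspace (MU X)" "c \<noteq> d"
    then obtain x where x: "x \<in> topspace X" "c {x} \<noteq> d {x}"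
      using possibility_capacity_eqI[OF X, of c d] by (auto simp: topspace_MU)
    then consider "c {x} < d {x}" | "d {x} < c {x}" by linarith
    then show "\<exists>U V. openin (MU X) U \<and> openin (MU X) V \<and> c \<in> U \<and> d \<in> V \<and> disjnt U V"
    proof cases
      case 1
      then show ?thesis using sep[OF cd(1,2) x(1)] by blast
    next
      case 2
      then show ?thesis using sep[OF cd(2,1) x(1)] disjnt_sym by blast
    qed
  qed
qed

lemma compactum_MU: "compactum X \<Longrightarrow> compactum (MU X)"
  using compact_space_MU Hausdorff_space_MU compactum_def by blast

section \<open>Action on continuous maps\<close>

lemma closedin_continuous_map_vimage:
  "continuous_map X Y f \<Longrightarrow> closedin Y F \<Longrightarrow> closedin X (f -` F \<inter> topspace X)"
  using closedin_continuous_map_preimage[of X Y f F]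
  by (simp add: vimage_def Int_def conj_commute)

text \<open>Only condition (3) goes beyond the behaviour of preimages under set operations: an open
  set around the preimage of \<open>F\<close> must be replaced by the preimage of an open set around
  \<open>F\<close>.\<close>

lemma possibility_capacity_MU_map:
  assumes X: "compactum X" and Y: "compactum Y" and f: "continuous_map X Y f"
    and c: "possibility_capacity X c"
  shows "possibility_capacity Y (MU_map X Y f c)"
proof -
  let ?p = "\<lambda>F. f -` F \<inter> topspace X"
  have cl: "closedin X (?p F)" if "closedin Y F" for F
    by (rule closedin_continuous_map_vimage[OF f that])
  have "\<exists>V. openin Y V \<and> F \<subseteq> V \<and> (\<forall>B. closedin Y B \<and> B \<subseteq> V \<longrightarrow> c (?p B) < a)"
    if F: "closedin Y F" "c (?p F) < a" for F a
  proof -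
    obtain V where V: "openin X V" "?p F \<subseteq> V" "\<forall>B. closedin X B \<and> B \<subseteq> V \<longrightarrow> c B < a"
      using capacity_usc[OF c cl[OF F(1)] F(2)] by (elim exE conjE)
    \<comment> \<open>Compact source and Hausdorff target make \<open>f\<close> closed, so removing
      the image of the complement of \<open>V\<close> leaves an open set whose preimage lies in
      \<open>V\<close>.\<close>
    have "closed_map X Y f"
      using X Y f by (simp add: compactum_def continuous_imp_closed_map_gen Hausdorff_imp_kc_space)
    then have "closedin Y (f ` (topspace X - V))" using V(1) unfolding closed_map_def by blast
    then have "openin Y (topspace Y - f ` (topspace X - V))" by (simp add: openin_diff)
    moreover have "F \<subseteq> topspace Y - f ` (topspace X - V)"
      using V(2) closedin_subset[OF F(1)] by auto
    moreover have "?p B \<subseteq> V" if "B \<subseteq> topspace Y - f ` (topspace X - V)" for B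
      using that by auto
    ultimately show ?thesis using V(3) cl
      by (intro exI[of _ "topspace Y - f ` (topspace X - V)"] conjI allI impI) simp_all
  qed
  moreover have "?p (topspace Y) = topspace X" using continuous_map_funspace[OF f] by auto
  moreover have "c (?p F) \<le> c (?p G)" if "closedin Y F" "closedin Y G" "F \<subseteq> G" for F G
    using that by (intro capacity_mono[OF c] cl) auto
  moreover have "c (?p (A \<union> B)) = max (c (?p A)) (c (?p B))" if "closedin Y A" "closedin Y B" for A B
    using capacity_Un[OF c cl[OF that(1)] cl[OF that(2)]] by (simp add: Int_Un_distrib2 vimage_Un)
  ultimately show ?thesis
    using closedin_Un[of Y]
    by (simp add: possibility_capacity_def capacity_def MU_map_def capacity_ge0[OF c] capacity_le1[OF c]
        capacity_empty[OF c] capacity_topspace[OF c])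
qed

lemma continuous_map_MU_map:
  assumes X: "compactum X" and Y: "compactum Y" and f: "continuous_map X Y f"
  shows "continuous_map (MU X) (MU Y) (MU_map X Y f)"
proof (rule continuous_map_into_MU[OF Y])
  show "possibility_capacity Y (MU_map X Y f c)" if "c \<in> topspace (MU X)" for c
    using possibility_capacity_MU_map[OF X Y f] that by (simp add: topspace_MU)
  have cl: "closedin X (f -` F \<inter> topspace X)" if "closedin Y F" for F
    by (rule closedin_continuous_map_vimage[OF f that])
  show "usc_map (MU X) (\<lambda>c. MU_map X Y f c F)" if F: "closedin Y F" for F
    using usc_map_MU_eval[OF cl[OF F]] F by (simp add: MU_map_def)
  show "openin (MU X) {c \<in> topspace (MU X). \<exists>y\<in>U. a < MU_map X Y f c {y}}"
    if U: "openin Y U" and a: "0 \<le> a" for U a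
  proof -
    have "(\<exists>y\<in>U. a < MU_map X Y f c {y}) \<longleftrightarrow> (\<exists>x\<in>{x \<in> topspace X. f x \<in> U}. a < c {x})"
      if "c \<in> topspace (MU X)" for c
    proof -
      have c: "possibility_capacity X c" using that by (simp add: topspace_MU)
      \<comment> \<open>The density of the image at \<open>y\<close> is governed by the densities
        over its fibre, so the lower condition on \<open>U\<close> becomes one on the open preimage
        of \<open>U\<close>.\<close>
      have "a < MU_map X Y f c {y} \<longleftrightarrow> (\<exists>x\<in>topspace X. f x = y \<and> a < c {x})" if "y \<in> U" for y
      proof -
        have "closedin Y {y}" using compactum_closedin_sing[OF Y] openin_subset[OF U] that by blast
        then show ?thesis using capacity_le_iff[OF c X cl a, of "{y}"]
          by (auto simp: MU_map_def not_le[symmetric])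
      qed
      then show ?thesis by auto
    qed
    then have "{c \<in> topspace (MU X). \<exists>y\<in>U. a < MU_map X Y f c {y}} =
        {c \<in> topspace (MU X). \<exists>x\<in>{x \<in> topspace X. f x \<in> U}. a < c {x}}" by blast
    then show ?thesis
      using openin_MU_gt[OF X openin_continuous_map_preimage[OF f U] a] by simp
  qed
qed

lemma MU_map_id:
  assumes "c \<in> topspace (MU X)"
  shows "MU_map X X id c = c"
proof
  fix F
  show "MU_map X X id c F = c F"
    using assms closedin_subset[of X F]
    by (cases "closedin X F") (auto simp: MU_map_def topspace_MU capacity_nonclosed Int_absorb2)
qed

lemma MU_map_comp:
  assumes f: "continuous_map X Y f" and g: "continuous_map Y Z g"
  shows "MU_map X Z (g \<circ> f) c = MU_map Y Z g (MU_map X Y f c)"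
proof
  fix F
  show "MU_map X Z (g \<circ> f) c F = MU_map Y Z g (MU_map X Y f c) F"
  proof (cases "closedin Z F")
    case True
    have "closedin Y (g -` F \<inter> topspace Y)"
      by (rule closedin_continuous_map_vimage[OF g True])
    moreover have "(g \<circ> f) -` F \<inter> topspace X = f -` (g -` F \<inter> topspace Y) \<inter> topspace X"
      using continuous_map_funspace[OF f] by auto
    ultimately show ?thesis using True by (simp add: MU_map_def)
  qed (simp add: MU_map_def)
qed

section \<open>The unit\<close>

text \<open>The density is the indicator of \<open>{x}\<close>, upper semicontinuous because points
  are closed.\<close>

lemma possibility_capacity_eta:
  assumes X: "compactum X" and x: "x \<in> topspace X"
  shows "possibility_capacity X (eta X x)"
proof (rule possibility_capacityI)
  let ?u = "\<lambda>y. if y = x then 1 else 0 :: real"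
  show "usc_map X ?u"
    unfolding usc_map_def
  proof
    fix a :: real
    consider "a \<le> 0" | "0 < a" "a \<le> 1" | "1 < a" by linarith
    then show "openin X {y \<in> topspace X. ?u y < a}"
    proof cases
      case 1
      then have "{y \<in> topspace X. ?u y < a} = {}" by auto
      then show ?thesis by (simp only: openin_empty)
    next
      case 2
      then have "{y \<in> topspace X. ?u y < a} = topspace X - {x}" by auto
      then show ?thesis using compactum_closedin_sing[OF X x] by (simp add: openin_diff)
    next
      case 3
      then have "{y \<in> topspace X. ?u y < a} = topspace X" by auto
      then show ?thesis by simp
    qed
  qed
qed (use x in \<open>auto simp: eta_def\<close>)

lemma continuous_map_eta:
  assumes X: "compactum X"
  shows "continuous_map X (MU X) (eta X)"
proof (rule continuous_map_into_MU[OF X possibility_capacity_eta[OF X]])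
  show "usc_map X (\<lambda>x. eta X x F)" if F: "closedin X F" for F
    unfolding usc_map_def
  proof
    fix a :: real
    consider "a \<le> 0" | "0 < a" "a \<le> 1" | "1 < a" by linarith
    then show "openin X {x \<in> topspace X. eta X x F < a}"
    proof cases
      case 1
      then have "{x \<in> topspace X. eta X x F < a} = {}" by (auto simp: eta_def)
      then show ?thesis by (simp only: openin_empty)
    next
      case 2
      then have "{x \<in> topspace X. eta X x F < a} = topspace X - F" using F by (auto simp: eta_def)
      then show ?thesis using F by (simp add: openin_diff)
    next
      case 3
      then have "{x \<in> topspace X. eta X x F < a} = topspace X" by (auto simp: eta_def)
      then show ?thesis by simp
    qed
  qed
  show "openin X {x \<in> topspace X. \<exists>y\<in>U. a < eta X x {y}}" if U: "openin X U" and a: "0 \<le> a" for U a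
  proof (cases "a < 1")
    case True
    then have "{x \<in> topspace X. \<exists>y\<in>U. a < eta X x {y}} = U"
      using a openin_subset[OF U] compactum_closedin_sing[OF X] by (auto simp: eta_def split: if_splits)
    then show ?thesis using U by simp
  next
    case False
    then have "{x \<in> topspace X. \<exists>y\<in>U. a < eta X x {y}} = {}"
      using a by (auto simp: eta_def split: if_splits)
    then show ?thesis by (simp only: openin_empty)
  qed
qed

lemma MU_map_eta:
  assumes f: "continuous_map X Y f" and x: "x \<in> topspace X"
  shows "MU_map X Y f (eta X x) = eta Y (f x)"
proof
  fix F
  have "closedin X (f -` F \<inter> topspace X)" if "closedin Y F"
    by (rule closedin_continuous_map_vimage[OF f that])
  then show "MU_map X Y f (eta X x) F = eta Y (f x) F" using x by (simp add: MU_map_def eta_def)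
qed

section \<open>The multiplication\<close>

lemma mu_nonclosed: "\<not> closedin X F \<Longrightarrow> mu X C F = 0"
  by (simp add: mu_def)

lemma closedin_level_set: "closedin X F \<Longrightarrow> closedin (MU X) (level_set X F t)"
proof -
  assume F: "closedin X F"
  have "level_set X F t = topspace (MU X) - {c \<in> topspace (MU X). c F < t}"
    by (auto simp: level_set_def)
  then show ?thesis using usc_mapD[OF usc_map_MU_eval[OF F], of t] by (simp add: closedin_diff)
qed

lemma bdd_above_mu:
  assumes C: "possibility_capacity (MU X) C"
  shows "bdd_above ((\<lambda>t. C (level_set X F t) * t) ` {0<..1})"
proof (rule bdd_aboveI[of _ 1])
  fix y assume "y \<in> (\<lambda>t. C (level_set X F t) * t) ` {0<..1}"
  then obtain t where "0 < t" "t \<le> 1" "y = C (level_set X F t) * t" by auto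
  then show "y \<le> 1" using capacity_le1[OF C] capacity_ge0[OF C] by (simp add: mult_le_one)
qed

lemma mu_ge0:
  assumes C: "possibility_capacity (MU X) C"
  shows "0 \<le> mu X C F"
proof (cases "closedin X F")
  case True
  have "C (level_set X F 1) * 1 \<le> mu X C F"
    unfolding mu_def if_P[OF True]
    by (rule cSup_upper[OF image_eqI[OF refl] bdd_above_mu[OF C]]) simp
  then show ?thesis using capacity_ge0[OF C, of "level_set X F 1"] by simp
qed (simp add: mu_nonclosed)

text \<open>Each level set is resolved into its points by \<open>capacity_le_iff\<close> on
  \<open>MU X\<close>; then the quantifier over \<open>t\<close> is eliminated.\<close>

lemma mu_le_iff:
  assumes X: "compactum X" and C: "possibility_capacity (MU X) C" and F: "closedin X F" and b: "0 \<le> b"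
  shows "mu X C F \<le> b \<longleftrightarrow> (\<forall>c\<in>topspace (MU X). C {c} * c F \<le> b)"
proof -
  have "mu X C F \<le> b \<longleftrightarrow> (\<forall>t\<in>{0<..1}. C (level_set X F t) * t \<le> b)"
    unfolding mu_def using F by (simp add: cSup_le_iff[OF _ bdd_above_mu[OF C]])
  also have "\<dots> \<longleftrightarrow> (\<forall>t\<in>{0<..1}. \<forall>c\<in>level_set X F t. C {c} * t \<le> b)"
  proof (rule ball_cong[OF refl])
    fix t :: real assume t: "t \<in> {0<..1}"
    then show "C (level_set X F t) * t \<le> b \<longleftrightarrow> (\<forall>c\<in>level_set X F t. C {c} * t \<le> b)"
      using capacity_le_iff[OF C compactum_MU[OF X] closedin_level_set[OF F], of "b / t" t] b
      by (simp add: pos_le_divide_eq)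
  qed
  also have "\<dots> \<longleftrightarrow> (\<forall>c\<in>topspace (MU X). C {c} * c F \<le> b)"
  proof
    \<comment> \<open>Use the level \<open>t = c F\<close>. The value 0 is not an admissible level,
      but then the product is 0.\<close>
    assume L: "\<forall>t\<in>{0<..1}. \<forall>c\<in>level_set X F t. C {c} * t \<le> b"
    show "\<forall>c\<in>topspace (MU X). C {c} * c F \<le> b"
    proof
      fix c assume c: "c \<in> topspace (MU X)"
      then have "0 \<le> c F" "c F \<le> 1" using capacity_ge0 capacity_le1 by (auto simp: topspace_MU)
      then show "C {c} * c F \<le> b"
        using L c b by (cases "c F = 0") (auto simp: level_set_def)
    qed
  next
    assume R: "\<forall>c\<in>topspace (MU X). C {c} * c F \<le> b"
    show "\<forall>t\<in>{0<..1}. \<forall>c\<in>level_set X F t. C {c} * t \<le> b"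
    proof (intro ballI)
      fix t c assume c: "c \<in> level_set X F t"
      then have "C {c} * t \<le> C {c} * c F"
        using capacity_ge0[OF C] by (intro mult_left_mono) (auto simp: level_set_def)
      also have "\<dots> \<le> b" using R c by (auto simp: level_set_def)
      finally show "C {c} * t \<le> b" .
    qed
  qed
  finally show ?thesis .
qed

text \<open>Semicontinuity in each variable separately would not suffice. A closed neighbourhood
  \<open>K\<close> of \<open>x\<close> with \<open>c K < a\<close> bounds \<open>d {y}\<close> by
  \<open>d K\<close> for all nearby \<open>d\<close> and \<open>y\<close> simultaneously.\<close>

lemma usc_map_joint_eval:
  assumes X: "compactum X"
  shows "usc_map (prod_topology (MU X) X) (\<lambda>(c, x). c {x})"
  unfolding usc_map_def
proof
  fix a
  show "openin (prod_topology (MU X) X) {z \<in> topspace (prod_topology (MU X) X). (case z of (c, x) \<Rightarrow> c {x}) < a}"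
  proof (subst openin_subopen, clarsimp)
    fix c x assume c: "c \<in> topspace (MU X)" and x: "x \<in> topspace X" and less: "c {x} < a"
    have pc: "possibility_capacity X c" using c by (simp add: topspace_MU)
    obtain V where V: "openin X V" "{x} \<subseteq> V" "\<forall>B. closedin X B \<and> B \<subseteq> V \<longrightarrow> c B < a"
      using capacity_usc[OF pc compactum_closedin_sing[OF X x] less] by (elim exE conjE)
    have "x \<in> V" using V(2) by simp
    then obtain W K where K: "openin X W" "closedin X K" "x \<in> W" "W \<subseteq> K" "K \<subseteq> V"
      by (rule compactum_closed_nbhd[OF X V(1)])
    let ?A = "{d \<in> topspace (MU X). d K < a}"
    have "openin (prod_topology (MU X) X) (?A \<times> W)"
      using usc_mapD[OF usc_map_MU_eval[OF K(2)]] K(1) by (simp add: openin_prod_Times_iff)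
    moreover have "(c, x) \<in> ?A \<times> W" using c K V(3) by auto
    moreover have *: "d \<in> topspace (MU X) \<and> y \<in> topspace X \<and> d {y} < a" if "d \<in> ?A" "y \<in> W" for d y
    proof -
      have y: "y \<in> topspace X" using that(2) openin_subset[OF K(1)] by blast
      have "d {y} \<le> d K"
        using that K(4) compactum_closedin_sing[OF X y]
        by (intro capacity_mono[of X] K(2)) (auto simp: topspace_MU)
      then show ?thesis using y that(1) by simp
    qed
    moreover have "?A \<times> W \<subseteq> {z. z \<in> topspace (MU X) \<times> topspace X \<and> (case z of (c, x) \<Rightarrow> c {x}) < a}"
    proof
      fix z assume "z \<in> ?A \<times> W"
      then obtain d y where z: "z = (d, y)" and "d \<in> ?A" "y \<in> W" by (rule SigmaE)
      show "z \<in> {z. z \<in> topspace (MU X) \<times> topspace X \<and> (case z of (c, x) \<Rightarrow> c {x}) < a}"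
        using *[OF \<open>d \<in> ?A\<close> \<open>y \<in> W\<close>] by (simp only: z mem_Collect_eq prod.case mem_Times_iff fst_conv snd_conv conj_assoc)
    qed
    ultimately show "\<exists>T. openin (prod_topology (MU X) X) T \<and> (c, x) \<in> T \<and>
        T \<subseteq> {z. z \<in> topspace (MU X) \<times> topspace X \<and> (case z of (c, x) \<Rightarrow> c {x}) < a}"
      by blast
  qed
qed

text \<open>The values at singletons serve as density: for each \<open>c\<close> the bound on
  \<open>C {c} * c F\<close> splits over the points of \<open>F\<close>, and the two universal
  quantifiers commute. The value 1 is reached at a point of density 1 for some \<open>c\<close>
  which itself has density 1 for \<open>C\<close>.\<close>

lemma possibility_capacity_mu:
  assumes X: "compactum X" and C: "C \<in> topspace (MU (MU X))"
  shows "possibility_capacity X (mu X C)"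
proof (rule possibility_capacityI[where u = "\<lambda>x. mu X C {x}"])
  have pC: "possibility_capacity (MU X) C" using C by (simp add: topspace_MU)
  note MX = compactum_MU[OF X]
  have pc: "possibility_capacity X c" if "c \<in> topspace (MU X)" for c using that by (simp add: topspace_MU)
  show "mu X C F = 0" if "\<not> closedin X F" for F using that by (rule mu_nonclosed)
  show "0 \<le> mu X C F" for F by (rule mu_ge0[OF pC])
  show le: "mu X C F \<le> b \<longleftrightarrow> (\<forall>x\<in>F. mu X C {x} \<le> b)" if F: "closedin X F" and b: "0 \<le> b" for F b
  proof -
    have "C {c} * c F \<le> b \<longleftrightarrow> (\<forall>x\<in>F. C {c} * c {x} \<le> b)" if c: "c \<in> topspace (MU X)" for c
    proof (cases "C {c} = 0")
      case False
      then have "0 < C {c}" using capacity_ge0[OF pC, of "{c}"] by simp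
      then show ?thesis
        using capacity_le_iff[OF pc[OF c] X F, of "b / C {c}"] b by (simp add: pos_le_divide_eq mult.commute)
    qed (simp add: b)
    moreover have "mu X C {x} \<le> b \<longleftrightarrow> (\<forall>c\<in>topspace (MU X). C {c} * c {x} \<le> b)" if "x \<in> F" for x
      by (rule mu_le_iff[OF X pC compactum_closedin_sing'[OF X F that] b])
    ultimately show ?thesis unfolding mu_le_iff[OF X pC F b] by blast
  qed
  have le1: "mu X C {x} \<le> 1" if "x \<in> topspace X" for x
    unfolding mu_le_iff[OF X pC compactum_closedin_sing[OF X that] zero_le_one]
    using capacity_le1[OF pC] capacity_ge0[OF pC] capacity_le1[OF pc] capacity_ge0[OF pc]
    by (simp add: mult_le_one)
  then show "mu X C {x} \<le> 1" if "x \<in> topspace X" for x using that .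
  obtain c where c: "c \<in> topspace (MU X)" "1 \<le> C {c}"
    using capacity_density_attained[OF pC MX closedin_topspace zero_less_one] capacity_topspace[OF pC] by auto
  obtain x where x: "x \<in> topspace X" "1 \<le> c {x}"
    using capacity_density_attained[OF pc[OF c(1)] X closedin_topspace zero_less_one]
      capacity_topspace[OF pc[OF c(1)]] by auto
  have "C {c} * c {x} \<le> mu X C {x}"
    using mu_le_iff[OF X pC compactum_closedin_sing[OF X x(1)] mu_ge0[OF pC], of "{x}"] c(1) by blast
  moreover have "C {c} = 1" "c {x} = 1"
    using c(2) x(2) capacity_le1[OF pC, of "{c}"] capacity_le1[OF pc[OF c(1)], of "{x}"] by auto
  ultimately show "\<exists>x\<in>topspace X. mu X C {x} = 1" using le1[OF x(1)] x(1) by force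
  show "usc_map X (\<lambda>x. mu X C {x})"
  proof (rule usc_map_Sup_compact)
    show "compact_space (MU X)" using MX by (simp add: compactum_def)
    let ?P = "prod_topology X (MU X)"
    have 1: "usc_map ?P (\<lambda>z. C {snd z})"
      by (rule usc_map_compose[OF usc_map_density[OF pC MX] continuous_map_snd])
    have "continuous_map ?P (prod_topology (MU X) X) (\<lambda>z. (snd z, fst z))"
      by (intro continuous_map_pairedI continuous_map_fst continuous_map_snd)
    from usc_map_compose[OF usc_map_joint_eval[OF X] this]
    have 2: "usc_map ?P (\<lambda>z. snd z {fst z})" by simp
    show "usc_map ?P (\<lambda>z. C {snd z} * snd z {fst z})"
      by (rule usc_map_mult[OF 1 2]) (auto simp: capacity_ge0[OF pC] intro: capacity_ge0[OF pc])
    show "mu X C {x} \<le> b \<longleftrightarrow> (\<forall>y\<in>topspace (MU X). C {snd (x, y)} * snd (x, y) {fst (x, y)} \<le> b)"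
      if "x \<in> topspace X" "0 \<le> b" for x b
      using mu_le_iff[OF X pC compactum_closedin_sing[OF X that(1)] that(2)] by simp
  qed (rule mu_ge0[OF pC])
qed

lemma continuous_map_mu:
  assumes X: "compactum X"
  shows "continuous_map (MU (MU X)) (MU X) (mu X)"
proof (rule continuous_map_into_MU[OF X possibility_capacity_mu[OF X]])
  note MX = compactum_MU[OF X]
  have pC: "possibility_capacity (MU X) C" if "C \<in> topspace (MU (MU X))" for C
    using that by (simp add: topspace_MU)
  have pc: "possibility_capacity X c" if "c \<in> topspace (MU X)" for c using that by (simp add: topspace_MU)
  show "usc_map (MU (MU X)) (\<lambda>C. mu X C F)" if F: "closedin X F" for F
  proof (rule usc_map_Sup_compact)
    show "compact_space (MU X)" using MX by (simp add: compactum_def)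
    let ?P = "prod_topology (MU (MU X)) (MU X)"
    have 1: "usc_map ?P (\<lambda>z. fst z {snd z})"
      using usc_map_joint_eval[OF MX] by (simp add: case_prod_beta')
    have 2: "usc_map ?P (\<lambda>z. snd z F)"
      by (rule usc_map_compose[OF usc_map_MU_eval[OF F] continuous_map_snd])
    show "usc_map ?P (\<lambda>z. fst z {snd z} * snd z F)"
      by (rule usc_map_mult[OF 1 2]) (auto intro: capacity_ge0[OF pC] capacity_ge0[OF pc])
    show "mu X C F \<le> b \<longleftrightarrow> (\<forall>c\<in>topspace (MU X). fst (C, c) {snd (C, c)} * snd (C, c) F \<le> b)"
      if "C \<in> topspace (MU (MU X))" "0 \<le> b" for C b
      using mu_le_iff[OF X pC[OF that(1)] F that(2)] by simp
  qed (rule mu_ge0[OF pC])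
  show "openin (MU (MU X)) {C \<in> topspace (MU (MU X)). \<exists>x\<in>U. a < mu X C {x}}"
    if U: "openin X U" and a: "0 \<le> a" for U a
  proof (subst openin_subopen, clarsimp)
    have gt: "a < mu X C {x} \<longleftrightarrow> (\<exists>c\<in>topspace (MU X). a < C {c} * c {x})"
      if "C \<in> topspace (MU (MU X))" "x \<in> U" for C x
    proof -
      have "closedin X {x}" using compactum_closedin_sing[OF X] openin_subset[OF U] that(2) by blast
      from mu_le_iff[OF X pC[OF that(1)] this a] show ?thesis by (auto simp: not_le[symmetric])
    qed
    fix C x assume C: "C \<in> topspace (MU (MU X))" and x: "x \<in> U" and "a < mu X C {x}"
    then obtain c where c: "c \<in> topspace (MU X)" "a < C {c} * c {x}" using gt by blast
    have c0: "0 < c {x}"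
      using c(2) a capacity_ge0[OF pc[OF c(1)], of "{x}"] by (cases "c {x} = 0") auto
    have "a / c {x} < C {c}" using c(2) c0 by (simp add: pos_divide_less_eq)
    \<comment> \<open>The threshold \<open>a\<close> is split into \<open>s\<close> for
      \<open>C\<close> and \<open>a / s\<close> for \<open>c\<close>; both inequalities are strict,
      hence persist on an open set, and together they bring the product back above
      \<open>a\<close>.\<close>
    then obtain s where s: "a / c {x} < s" "s < C {c}" using dense by blast
    have s0: "0 < s" using s(1) a c0 by (meson divide_nonneg_pos le_less_trans)
    have t: "a / s < c {x}" using s(1) s0 c0 by (simp add: pos_divide_less_eq mult.commute)
    let ?W = "{d \<in> topspace (MU X). \<exists>x\<in>U. a / s < d {x}}"
    let ?T = "{D \<in> topspace (MU (MU X)). \<exists>d\<in>?W. s < D {d}}"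
    have "openin (MU X) ?W" using openin_MU_gt[OF X U, of "a / s"] a s0 by simp
    then have "openin (MU (MU X)) ?T" by (rule openin_MU_gt[OF MX _ less_imp_le[OF s0]])
    moreover have "C \<in> ?T" using C c(1) x s(2) t by blast
    moreover have "\<exists>x\<in>U. a < mu X D {x}" if D: "D \<in> ?T" for D
    proof -
      obtain d y where d: "d \<in> topspace (MU X)" "y \<in> U" "a / s < d {y}" "s < D {d}" using D by blast
      have "a = s * (a / s)" using s0 by simp
      also have "\<dots> < s * d {y}" using d(3) s0 by (rule mult_strict_left_mono)
      also have "\<dots> \<le> D {d} * d {y}"
        using d(4) capacity_ge0[OF pc[OF d(1)]] by (intro mult_right_mono) auto
      finally show ?thesis using gt[of D y] D d(1,2) by blast
    qed
    ultimately show "\<exists>T. openin (MU (MU X)) T \<and> C \<in> T \<and>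
        T \<subseteq> {C \<in> topspace (MU (MU X)). \<exists>x\<in>U. a < mu X C {x}}"
      by (intro exI[of _ ?T]) blast
  qed
qed

section \<open>Naturality and the monad laws\<close>

text \<open>This makes the two suprema in the naturality of \<open>mu\<close> agree term by
  term.\<close>

lemma vimage_level_set:
  assumes X: "compactum X" and Y: "compactum Y" and f: "continuous_map X Y f" and F: "closedin Y F"
  shows "MU_map X Y f -` level_set Y F t \<inter> topspace (MU X) = level_set X (f -` F \<inter> topspace X) t"
  using possibility_capacity_MU_map[OF X Y f] F
  by (auto simp: level_set_def topspace_MU MU_map_def)

lemma MU_map_mu:
  assumes X: "compactum X" and Y: "compactum Y" and f: "continuous_map X Y f"
  shows "MU_map X Y f (mu X C) = mu Y (MU_map (MU X) (MU Y) (MU_map X Y f) C)"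
proof
  fix F
  show "MU_map X Y f (mu X C) F = mu Y (MU_map (MU X) (MU Y) (MU_map X Y f) C) F"
  proof (cases "closedin Y F")
    case F: True
    have "closedin X (f -` F \<inter> topspace X)"
      by (rule closedin_continuous_map_vimage[OF f F])
    moreover have "MU_map (MU X) (MU Y) (MU_map X Y f) C (level_set Y F t) = C (level_set X (f -` F \<inter> topspace X) t)" for t
      using closedin_level_set[OF F] vimage_level_set[OF X Y f F] by (simp add: MU_map_def)
    ultimately show ?thesis using F by (simp add: MU_map_def[of X Y f] mu_def)
  qed (simp add: MU_map_def mu_nonclosed)
qed

text \<open>The density of \<open>eta (MU X) c\<close> is the indicator of \<open>c\<close>, so only
  the term at \<open>c\<close> contributes.\<close>

lemma mu_eta:
  assumes X: "compactum X" and c: "c \<in> topspace (MU X)"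
  shows "mu X (eta (MU X) c) = c"
proof
  fix F
  have pc: "possibility_capacity X c" using c by (simp add: topspace_MU)
  have pe: "possibility_capacity (MU X) (eta (MU X) c)"
    by (rule possibility_capacity_eta[OF compactum_MU[OF X] c])
  show "mu X (eta (MU X) c) F = c F"
  proof (cases "closedin X F")
    case F: True
    have e: "eta (MU X) c {d} = (if d = c then 1 else 0)" if "d \<in> topspace (MU X)" for d
      using compactum_closedin_sing[OF compactum_MU[OF X] that] by (auto simp: eta_def)
    have "mu X (eta (MU X) c) F \<le> b \<longleftrightarrow> c F \<le> b" if b: "0 \<le> b" for b
      unfolding mu_le_iff[OF X pe F b] using c b by (auto simp: e)
    \<comment> \<open>Nonnegative numbers with the same nonnegative upper bounds are equal: take
      each of them as \<open>b\<close>.\<close>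
    from this[OF capacity_ge0[OF pc, of F]] this[OF mu_ge0[OF pe, of F]] show ?thesis by simp
  qed (simp add: mu_nonclosed capacity_nonclosed[OF pc])
qed

text \<open>For every level \<open>t\<close> in \<open>(0,1]\<close> the points with
  \<open>eta X x F \<ge> t\<close> are exactly those of \<open>F\<close>, so the terms are
  \<open>c F * t\<close>, with maximum at \<open>t = 1\<close>. Positivity of \<open>t\<close>
  matters here.\<close>

lemma mu_MU_map_eta:
  assumes X: "compactum X" and c: "c \<in> topspace (MU X)"
  shows "mu X (MU_map X (MU X) (eta X) c) = c"
proof
  fix F
  have pc: "possibility_capacity X c" using c by (simp add: topspace_MU)
  show "mu X (MU_map X (MU X) (eta X) c) F = c F"
  proof (cases "closedin X F")
    case F: True
    have "MU_map X (MU X) (eta X) c (level_set X F t) = c F" if "t \<in> {0<..1}" for t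
    proof -
      have "eta X -` level_set X F t \<inter> topspace X = F"
        using that F closedin_subset[OF F] possibility_capacity_eta[OF X]
        by (auto simp: level_set_def topspace_MU eta_def split: if_splits)
      then show ?thesis using closedin_level_set[OF F] by (simp add: MU_map_def)
    qed
    then have "mu X (MU_map X (MU X) (eta X) c) F = Sup ((\<lambda>t. c F * t) ` {0<..1})"
      using F by (simp add: mu_def)
    also have "\<dots> = c F"
    proof (rule cSup_eq_maximum)
      show "c F \<in> (\<lambda>t. c F * t) ` {0<..1}" by (rule image_eqI[of _ _ 1]) auto
      show "y \<le> c F" if "y \<in> (\<lambda>t. c F * t) ` {0<..1}" for y
        using that capacity_ge0[OF pc, of F] by (auto intro: mult_left_le)
    qed
    finally show ?thesis .
  qed (simp add: mu_nonclosed capacity_nonclosed[OF pc])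
qed

text \<open>Both sides are the supremum of \<open>D {C} * C {c} * c F\<close> over all \<open>C\<close> and \<open>c\<close>.\<close>
lemma mu_assoc:
  assumes X: "compactum X" and D: "D \<in> topspace (MU (MU (MU X)))"
  shows "mu X (mu (MU X) D) = mu X (MU_map (MU (MU X)) (MU X) (mu X) D)"
proof
  fix F
  note MX = compactum_MU[OF X] note MMX = compactum_MU[OF MX]
  have pD: "possibility_capacity (MU (MU X)) D" using D by (simp add: topspace_MU)
  have pC: "possibility_capacity (MU X) C" if "C \<in> topspace (MU (MU X))" for C
    using that by (simp add: topspace_MU)
  have pc: "possibility_capacity X c" if "c \<in> topspace (MU X)" for c using that by (simp add: topspace_MU)
  let ?L = "mu (MU X) D" and ?R = "MU_map (MU (MU X)) (MU X) (mu X) D"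
  have pL: "possibility_capacity (MU X) ?L" by (rule possibility_capacity_mu[OF MX D])
  have pR: "possibility_capacity (MU X) ?R"
    by (rule possibility_capacity_MU_map[OF MMX MX continuous_map_mu[OF X] pD])
  show "mu X ?L F = mu X ?R F"
  proof (cases "closedin X F")
    case F: True
    have "mu X ?L F \<le> b \<longleftrightarrow> mu X ?R F \<le> b" if b: "0 \<le> b" for b
    proof -
      \<comment> \<open>Dividing by \<open>c F\<close> reduces this to \<open>mu_le_iff\<close> one
        level higher; for \<open>c F = 0\<close> both sides hold since \<open>b\<close> is
        nonnegative.\<close>
      have "?L {c} * c F \<le> b \<longleftrightarrow> (\<forall>C\<in>topspace (MU (MU X)). D {C} * (C {c} * c F) \<le> b)"
        if c: "c \<in> topspace (MU X)" for c
      proof (cases "c F = 0")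
        case False
        then have "0 < c F" using capacity_ge0[OF pc[OF c], of F] by simp
        then show ?thesis
          using mu_le_iff[OF MX pD compactum_closedin_sing[OF MX c], of "b / c F"] b
          by (simp add: pos_le_divide_eq mult.assoc)
      qed (simp add: b)
      then have "mu X ?L F \<le> b \<longleftrightarrow>
          (\<forall>C\<in>topspace (MU (MU X)). \<forall>c\<in>topspace (MU X). D {C} * (C {c} * c F) \<le> b)"
        unfolding mu_le_iff[OF X pL F b] by blast
      also have "\<dots> \<longleftrightarrow> (\<forall>C\<in>topspace (MU (MU X)). D {C} * mu X C F \<le> b)"
      proof (rule ball_cong[OF refl])
        fix C assume C: "C \<in> topspace (MU (MU X))"
        show "(\<forall>c\<in>topspace (MU X). D {C} * (C {c} * c F) \<le> b) \<longleftrightarrow> D {C} * mu X C F \<le> b"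
        proof (cases "D {C} = 0")
          case False
          then have "0 < D {C}" using capacity_ge0[OF pD, of "{C}"] by simp
          then show ?thesis
            using mu_le_iff[OF X pC[OF C] F, of "b / D {C}"] b
            by (simp add: pos_le_divide_eq mult.commute)
        qed (simp add: b)
      qed
      also have "\<dots> \<longleftrightarrow> (\<forall>c\<in>topspace (MU X). ?R {c} * c F \<le> b)"
      proof -
        \<comment> \<open>\<open>?R {c}\<close> is governed by the \<open>D {C}\<close> over the
          fibre \<open>mu X C = c\<close>. As \<open>c\<close> varies, these fibres exhaust all
          \<open>C\<close>, because \<open>mu X C\<close> is again a point of
          \<open>MU X\<close>.\<close>
        have "?R {c} * c F \<le> b \<longleftrightarrow> (\<forall>C\<in>topspace (MU (MU X)). mu X C = c \<longrightarrow> D {C} * c F \<le> b)"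
          if c: "c \<in> topspace (MU X)" for c
        proof (cases "c F = 0")
          case False
          then have "0 < c F" using capacity_ge0[OF pc[OF c], of F] by simp
          have c': "closedin (MU X) {c}" by (rule compactum_closedin_sing[OF MX c])
          have "closedin (MU (MU X)) (mu X -` {c} \<inter> topspace (MU (MU X)))"
            by (rule closedin_continuous_map_vimage[OF continuous_map_mu[OF X] c'])
          from capacity_le_iff[OF pD MMX this, of "b / c F"] show ?thesis
            using b \<open>0 < c F\<close> c' by (auto simp: pos_le_divide_eq MU_map_def)
        qed (simp add: b)
        moreover have "mu X C \<in> topspace (MU X)" if "C \<in> topspace (MU (MU X))" for C
          using possibility_capacity_mu[OF X that] by (simp add: topspace_MU)
        ultimately show ?thesis by blast
      qed
      also have "\<dots> \<longleftrightarrow> mu X ?R F \<le> b" by (rule mu_le_iff[OF X pR F b, symmetric])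
      finally show ?thesis .
    qed
    from this[OF mu_ge0[OF pL, of F]] this[OF mu_ge0[OF pR, of F]] show ?thesis by simp
  qed (simp add: mu_nonclosed)
qed

theorem theorem1:
  fixes X :: "'a topology" and Y :: "'b topology" and Z :: "'c topology"
    and f :: "'a \<Rightarrow> 'b" and g :: "'b \<Rightarrow> 'c"
  assumes "compactum X" and "compactum Y" and "compactum Z"
    and "continuous_map X Y f" and "continuous_map Y Z g"
  shows
    \<comment> \<open>M_cup is an endofunctor of compacta\<close>
    "compactum (MU X)
     \<and> continuous_map (MU X) (MU Y) (MU_map X Y f)
     \<and> (\<forall>c\<in>topspace (MU X). MU_map X X id c = c)
     \<and> (\<forall>c\<in>topspace (MU X).
          MU_map X Z (g \<circ> f) c = MU_map Y Z g (MU_map X Y f c))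
     \<comment> \<open>eta and mu are continuous and natural\<close>
     \<and> continuous_map X (MU X) (eta X)
     \<and> continuous_map (MU (MU X)) (MU X) (mu X)
     \<and> (\<forall>x\<in>topspace X. MU_map X Y f (eta X x) = eta Y (f x))
     \<and> (\<forall>C\<in>topspace (MU (MU X)).
          MU_map X Y f (mu X C) = mu Y (MU_map (MU X) (MU Y) (MU_map X Y f) C))
     \<comment> \<open>(i) unit laws\<close>
     \<and> (\<forall>c\<in>topspace (MU X). mu X (eta (MU X) c) = c)
     \<and> (\<forall>c\<in>topspace (MU X). mu X (MU_map X (MU X) (eta X) c) = c)
     \<comment> \<open>(ii) associativity\<close>
     \<and> (\<forall>D\<in>topspace (MU (MU (MU X))).
          mu X (mu (MU X) D) = mu X (MU_map (MU (MU X)) (MU X) (mu X) D))"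
  using compactum_MU[OF assms(1)] continuous_map_MU_map[OF assms(1,2,4)] MU_map_id[of _ X]
    MU_map_comp[OF assms(4,5)] continuous_map_eta[OF assms(1)] continuous_map_mu[OF assms(1)]
    MU_map_eta[OF assms(4)] MU_map_mu[OF assms(1,2,4)] mu_eta[OF assms(1)]
    mu_MU_map_eta[OF assms(1)] mu_assoc[OF assms(1)]
  by (intro conjI ballI)

end
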